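(* Let $F$ be a nilpotent cellular automaton on $\mathcal{X}=\mathcal{A}^{\mathbb{Z}^d}$, let $0\in\mathcal{A}$ be the symbol such that $F^N$ is the constant map equal to $0^\infty$ for some integer $N\ge 1$, and let $(F_\epsilon)_{\epsilon>0}$ be a family of probabilistic cellular automata such that each $F_\epsilon$ is an $\epsilon$-perturbation of $F$. For $\epsilon$ small enough, denote by $\pi_\epsilon$ the unique $F_\epsilon$-invariant probability measure. Then there is a constant $C>0$ (independent of $A$ and of $\epsilon$) such that for all finite $A\subset\mathbb{Z}^d$ (and all $\epsilon$ small enough that $\pi_\epsilon$ is defined), $$\|\delta_0-\pi_\epsilon\|_A\le 1-(1-\epsilon)^{|A|C}\le C|A|\epsilon .$$
   Context: $\mathcal{A}$ is a finite alphabet, $d\ge1$, and $\mathcal{X}=\mathcal{A}^{\mathbb{Z}^d}$ has the product topology. A map $F:\mathcal{X}\to\mathcal{X}$ is a cellular automaton (CA) if there are a finite neighborhood $\mathcal{N}=\{i_1,\dots,i_r\}\subset\mathbb{Z}^d$ and a local rule $f:\mathcal{A}^{\mathcal{N}}\to\mathcal{A}$ with $(Fx)_i=f(x_{i+\mathcal{N}})$ for all $i$, where $x_{i+\mathcal{N}}=(x_{i+i_1},\dots,x_{i+i_r})$. A transition kernel $\Phi$ on $\mathcal{X}$ is a probabilistic cellular automaton (PCA) if there are a finite neighborhood $\mathcal{N}$ and a stochastic matrix $\varphi:\mathcal{A}^{\mathcal{N}}\times\mathcal{A}\to[0,1]$ (local rule) such that for all $x\in\mathcal{X}$, finite $A\subset\mathbb{Z}^d$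 and $u\in\mathcal{A}^A$, $\Phi(x,[u]_A)=\prod_{i\in A}\varphi(x_{i+\mathcal{N}},u_i)$, where $[u]_A=\{y\in\mathcal{X}: y_i=u_i\ \forall i\in A\}$. A PCA with local rule $\varphi$ is an $\epsilon$-perturbation of a CA with local rule $f$ if they have the same alphabet and the same neighborhood, and $\varphi((a_1,\dots,a_r),f(a_1,\dots,a_r))\ge 1-\epsilon$ for all $a_1,\dots,a_r\in\mathcal{A}$. A PCA acts on the set $\mathcal{M}(\mathcal{X})$ of Borel probability measures by $\Phi\mu(B)=\int\Phi(x,B)\,d\mu(x)$; $\mu$ is $\Phi$-invariant if $\Phi\mu=\mu$. A CA $F$ is nilpotent if there is an integer $N\ge1$ such that $F^N$ is a constant function; by shift-invariance the constant is then of the form $0^\infty$ for some symbol denoted $0\in\mathcal{A}$, where $a^\infty$ is the configuration with all cells equal to $a$. $\delta_a$ denotes the Dirac mass at $a^\infty$. It is a known fact that, for nilpotent $F$ and all small enough $\epsilon$, every $\epsilon$-perturbation of $F$ has a unique invariant measure. For finite $A\subset\mathbb{Z}^d$ and $\mu,\nu\in\mathcal{M}(\mathcal{X})$, $\|\mu-\nu\|_A=\frac12\sum_{u\in\mathcal{A}^A}|\mu([u]_A)-\nu([u]_A)|$. *)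

theory Defs
  imports "HOL-Probability.Probability"
begin

text \<open>
  The lattice is \<open>int ^ 'd\<close>, with dimension \<open>CARD('d) \<ge> 1\<close>.  The alphabet is a finite type
  carrying the discrete topology, so that the function type below has the product topology and
  \<^term>\<open>borel\<close> is its Borel sigma-algebra.
\<close>

type_synonym ('a, 'd) config = "(int ^ 'd) \<Rightarrow> 'a"

text \<open>
  For a finite set \<open>A\<close> of cells, \<open>\<A>\<^sup>A\<close> is rendered as the set \<open>A \<rightarrow>\<^sub>E UNIV\<close> of extensional functions;
  it is finite.
\<close>

definition local_pattern :: "(int ^ 'd) set \<Rightarrow> ('a, 'd) config \<Rightarrow> int ^ 'd \<Rightarrow> ('a, 'd) config" where
  "local_pattern N x i = (\<lambda>k\<in>N. x (i + k))"

definition cylinder :: "(int ^ 'd) set \<Rightarrow> ('a, 'd) config \<Rightarrow> ('a, 'd) config set" where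
  "cylinder A u = {y. \<forall>i\<in>A. y i = u i}"

text \<open>Only the values of a local rule on \<open>N \<rightarrow>\<^sub>E UNIV\<close> matter.\<close>

definition CA_with_rule ::
    "(int ^ 'd) set \<Rightarrow> (('a, 'd) config \<Rightarrow> 'a) \<Rightarrow> (('a, 'd) config \<Rightarrow> ('a, 'd) config) \<Rightarrow> bool" where
  "CA_with_rule N f F \<longleftrightarrow> finite N \<and> (\<forall>x i. F x i = f (local_pattern N x i))"

definition nilpotent :: "(('a, 'd) config \<Rightarrow> ('a, 'd) config) \<Rightarrow> bool" where
  "nilpotent F \<longleftrightarrow> (\<exists>n\<ge>1. \<exists>c. \<forall>x. (F ^^ n) x = c)"

definition stochastic_matrix ::
    "(int ^ 'd) set \<Rightarrow> (('a::finite, 'd) config \<Rightarrow> 'a \<Rightarrow> real) \<Rightarrow> bool" where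
  "stochastic_matrix N \<phi> \<longleftrightarrow>
     (\<forall>a \<in> N \<rightarrow>\<^sub>E UNIV. (\<forall>b. 0 \<le> \<phi> a b \<and> \<phi> a b \<le> 1) \<and> (\<Sum>b\<in>UNIV. \<phi> a b) = 1)"

definition PCA_with_rule ::
    "(int ^ 'd) set \<Rightarrow> (('a::{finite, discrete_topology}, 'd) config \<Rightarrow> 'a \<Rightarrow> real) \<Rightarrow>
     (('a, 'd) config \<Rightarrow> ('a, 'd) config measure) \<Rightarrow> bool" where
  "PCA_with_rule N \<phi> \<Phi> \<longleftrightarrow>
     finite N \<and> stochastic_matrix N \<phi> \<and> \<Phi> \<in> borel \<rightarrow>\<^sub>M prob_algebra borel \<and>
     (\<forall>x A. finite A \<longrightarrow> (\<forall>u \<in> A \<rightarrow>\<^sub>E UNIV.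
        measure (\<Phi> x) (cylinder A u) = (\<Prod>i\<in>A. \<phi> (local_pattern N x i) (u i))))"

text \<open>
  The PCA has the same neighborhood \<open>N\<close> as the CA with local rule \<open>f\<close>.
\<close>

definition perturbation ::
    "real \<Rightarrow> (int ^ 'd) set \<Rightarrow> (('a::{finite, discrete_topology}, 'd) config \<Rightarrow> 'a) \<Rightarrow>
     (('a, 'd) config \<Rightarrow> ('a, 'd) config measure) \<Rightarrow> bool" where
  "perturbation \<epsilon> N f \<Phi> \<longleftrightarrow>
     (\<exists>\<phi>. PCA_with_rule N \<phi> \<Phi> \<and> (\<forall>a \<in> N \<rightarrow>\<^sub>E UNIV. \<phi> a (f a) \<ge> 1 - \<epsilon>))"

text \<open>
  The action of a kernel on measures is the monadic bind:
  \<open>emeasure (\<mu> \<bind> \<Phi>) B = (\<integral>\<^sup>+x. emeasure (\<Phi> x) B \<partial>\<mu>)\<close>, by \<open>emeasure_bind\<close>.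
\<close>

definition invariant_measure ::
    "(('a::topological_space, 'd) config \<Rightarrow> ('a, 'd) config measure) \<Rightarrow>
     ('a, 'd) config measure \<Rightarrow> bool" where
  "invariant_measure \<Phi> \<mu> \<longleftrightarrow> \<mu> \<in> space (prob_algebra borel) \<and> \<mu> \<bind> \<Phi> = \<mu>"

definition unique_invariant_measure ::
    "(('a::topological_space, 'd) config \<Rightarrow> ('a, 'd) config measure) \<Rightarrow>
     ('a, 'd) config measure \<Rightarrow> bool" where
  "unique_invariant_measure \<Phi> \<pi> \<longleftrightarrow>
     invariant_measure \<Phi> \<pi> \<and> (\<forall>\<mu>. invariant_measure \<Phi> \<mu> \<longrightarrow> \<mu> = \<pi>)"

definition dirac_const :: "'a::topological_space \<Rightarrow> ('a, 'd) config measure" where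
  "dirac_const a = return borel (\<lambda>_. a)"

definition tv_dist ::
    "(int ^ 'd) set \<Rightarrow> ('a::finite, 'd) config measure \<Rightarrow> ('a, 'd) config measure \<Rightarrow> real" where
  "tv_dist A \<mu> \<nu> =
     1 / 2 * (\<Sum>u \<in> A \<rightarrow>\<^sub>E UNIV. \<bar>measure \<mu> (cylinder A u) - measure \<nu> (cylinder A u)\<bar>)"

end

theory Submission
  imports Defs
begin

text \<open>
  Let \<open>S\<^sub>k\<close> be the set of configurations \<open>x\<close> such that \<open>F\<^sup>k x\<close> equals \<open>z\<close> on the finite set \<open>A\<close>.
  Thus \<open>S\<^sub>0\<close> is the cylinder of the all-\<open>z\<close> pattern on \<open>A\<close>, and \<open>S\<^sub>n\<close> is the whole space once
  \<open>F\<^sup>n\<close> is the constant map to \<open>z\<close>.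

  The idea is that one application of the kernel imitates one application of \<open>F\<close> without any error
  on a prescribed finite set \<open>D\<close> of cells with probability at least \<open>(1 - \<epsilon>)\<^bsup>card D\<^esup>\<close>
  (\<open>perturbation_error_free\<close>).  Take for \<open>D\<close> the cells that determine \<open>F\<^sup>k\<close> on \<open>A\<close>; there are at most
  \<open>card A * (card N)\<^sup>k\<close> of them.  If \<open>x\<close> is in \<open>S\<^bsub>k+1\<^esub>\<close> and \<open>y\<close> agrees with \<open>F x\<close> on \<open>D\<close>, then
  \<open>F\<^sup>k y = F\<^sup>k (F x) = z\<close> on \<open>A\<close>, so \<open>y\<close> is in \<open>S\<^sub>k\<close>.  An invariant measure \<open>\<pi>\<close> is the law of the
  configuration after one step started from \<open>\<pi>\<close>, so
  \<open>\<pi> S\<^sub>k \<ge> (1 - \<epsilon>)\<^bsup>card D\<^esup> * \<pi> S\<^bsub>k+1\<^esub>\<close> (\<open>invariant_measure_ge\<close>).  Chaining these bounds from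
  \<open>k = 0\<close> to \<open>n - 1\<close>, with \<open>\<pi> S\<^sub>n = 1\<close> at the end, gives \<open>\<pi> S\<^sub>0 \<ge> (1 - \<epsilon>)\<^bsup>card A * C\<^esup>\<close> with \<open>C = (\<Sum>k<n. (card N)\<^sup>k)\<close>
  (\<open>measure_iterate_constant_ge\<close>).

  The distance to a Dirac mass on \<open>A\<close> is the mass that \<open>\<pi>\<close> puts outside that cylinder
  (\<open>tv_dist_dirac_const\<close>), which gives the first inequality.  The second one is Bernoulli's.
\<close>

section \<open>Cylinders and local events\<close>

lemma open_cylinder:
  fixes u :: "('a::discrete_topology, 'd::finite) config"
  assumes "finite A"
  shows "open (cylinder A u)"
proof -
  have "cylinder A u = (\<Inter>i\<in>A. (\<lambda>y. y i) -` {u i})"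
    by (auto simp: cylinder_def)
  moreover have "open ((\<lambda>y::('a, 'd) config. y i) -` {u i})" for i
    by (intro open_vimage continuous_on_product_coordinates) (simp add: Topological_Spaces.open_discrete)
  ultimately show ?thesis
    using assms by auto
qed

text \<open>
  An event decided by finitely many cells contains the cylinder around each of its points, so
  it is open; measurability of the sets \<open>S\<^sub>k\<close> comes from here.
\<close>

lemma borel_local_event:
  fixes S :: "('a::discrete_topology, 'd::finite) config set"
  assumes "finite D" and "\<And>x y. x \<in> S \<Longrightarrow> (\<And>i. i \<in> D \<Longrightarrow> y i = x i) \<Longrightarrow> y \<in> S"
  shows "S \<in> sets borel"
proof -
  have "S = (\<Union>x\<in>S. cylinder D x)"
    using assms(2) by (auto simp: cylinder_def)
  moreover have "open (\<Union>x\<in>S. cylinder D x)"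
    using assms(1) by (auto intro: open_cylinder)
  ultimately show ?thesis
    by simp
qed

lemma cylinder_restrict [simp]: "cylinder A (restrict u A) = cylinder A u"
  by (auto simp: cylinder_def)

lemma sum_measure_cylinder:
  fixes \<mu> :: "('a::{finite, discrete_topology}, 'd::finite) config measure"
  assumes "finite A" and "\<mu> \<in> space (prob_algebra borel)"
  shows "(\<Sum>u\<in>A \<rightarrow>\<^sub>E UNIV. measure \<mu> (cylinder A u)) = 1"
proof -
  interpret prob_space \<mu>
    using assms(2) by (simp add: space_prob_algebra)
  have sets: "sets \<mu> = sets borel"
    using assms(2) by (simp add: space_prob_algebra)
  have "(\<Sum>u\<in>A \<rightarrow>\<^sub>E UNIV. prob (cylinder A u)) = prob (\<Union>u\<in>A \<rightarrow>\<^sub>E UNIV. cylinder A u)"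
  proof (rule finite_measure_finite_Union [symmetric])
    show "finite (A \<rightarrow>\<^sub>E (UNIV :: 'a set))"
      using assms(1) by (auto intro: finite_PiE)
    show "cylinder A ` (A \<rightarrow>\<^sub>E UNIV) \<subseteq> events"
      using open_cylinder [OF assms(1)] by (auto simp: sets intro: borel_open)
    show "disjoint_family_on (cylinder A) (A \<rightarrow>\<^sub>E (UNIV :: 'a set))"
      unfolding disjoint_family_on_def
    proof (intro ballI impI)
      fix u v :: "('a, 'd) config"
      assume "u \<in> A \<rightarrow>\<^sub>E UNIV" "v \<in> A \<rightarrow>\<^sub>E UNIV" "u \<noteq> v"
      then obtain i where "i \<in> A" "u i \<noteq> v i"
        by (meson PiE_ext)
      then show "cylinder A u \<inter> cylinder A v = {}"
        by (auto simp: cylinder_def)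
    qed
  qed
  also have "(\<Union>u\<in>A \<rightarrow>\<^sub>E UNIV. cylinder A u) = (UNIV :: ('a, 'd) config set)"
  proof (intro equalityI subsetI)
    fix x :: "('a, 'd) config"
    have "x \<in> cylinder A (restrict x A)"
      by (simp add: cylinder_def)
    moreover have "restrict x A \<in> A \<rightarrow>\<^sub>E UNIV"
      by simp
    ultimately show "x \<in> (\<Union>u\<in>A \<rightarrow>\<^sub>E UNIV. cylinder A u)"
      by (rule UN_I [rotated])
  qed simp
  also have "prob UNIV = 1"
    using prob_space sets_eq_imp_space_eq [OF sets] by simp
  finally show ?thesis .
qed

text \<open>
  The all-\<open>z\<close> pattern contributes \<open>1 - p\<close> with \<open>p\<close> its \<open>\<mu>\<close>-mass, and the other patterns, which the
  Dirac mass does not charge, contribute the remaining mass \<open>1 - p\<close> once more; the factor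
  \<open>1 / 2\<close> in the distance compensates for this.
\<close>

lemma tv_dist_dirac_const:
  fixes \<mu> :: "('a::{finite, discrete_topology}, 'd::finite) config measure"
  assumes "finite A" and \<mu>: "\<mu> \<in> space (prob_algebra borel)"
  shows "tv_dist A (dirac_const z) \<mu> = 1 - measure \<mu> (cylinder A (\<lambda>_. z))"
proof -
  interpret prob_space \<mu>
    using \<mu> by (simp add: space_prob_algebra)
  define Z where "Z = restrict (\<lambda>_. z) A"
  define p where "p = (\<lambda>u. prob (cylinder A u))"
  have Z: "Z \<in> A \<rightarrow>\<^sub>E UNIV"
    by (simp add: Z_def)
  have fin: "finite (A \<rightarrow>\<^sub>E (UNIV :: 'a set))"
    using assms(1) by (auto intro: finite_PiE)
  have dirac: "measure (dirac_const z) (cylinder A u) = (if u = Z then 1 else 0)"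
    if "u \<in> A \<rightarrow>\<^sub>E UNIV" for u :: "('a, 'd) config"
  proof -
    have "(\<lambda>_. z) \<in> cylinder A u \<longleftrightarrow> u = Z"
      using that by (force simp: cylinder_def Z_def fun_eq_iff PiE_def extensional_def)
    then show ?thesis
      using open_cylinder [OF assms(1), of u]
      by (simp add: dirac_const_def measure_return indicator_def)
  qed
  have "(\<Sum>u\<in>A \<rightarrow>\<^sub>E UNIV. \<bar>measure (dirac_const z) (cylinder A u) - p u\<bar>)
      = (\<Sum>u\<in>A \<rightarrow>\<^sub>E UNIV. \<bar>(if u = Z then 1 else 0) - p u\<bar>)"
    by (intro sum.cong refl) (simp add: dirac)
  also have "\<dots> = \<bar>1 - p Z\<bar> + (\<Sum>u\<in>(A \<rightarrow>\<^sub>E UNIV) - {Z}. p u)"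
    unfolding sum.remove [OF fin Z] by (auto simp: p_def intro!: sum.cong)
  also have "(\<Sum>u\<in>(A \<rightarrow>\<^sub>E UNIV) - {Z}. p u) = 1 - p Z"
    using sum.remove [OF fin Z, of p] sum_measure_cylinder [OF assms] by (simp add: p_def)
  finally have "tv_dist A (dirac_const z) \<mu> = 1 - p Z"
    by (simp add: tv_dist_def p_def)
  then show ?thesis
    by (simp add: p_def Z_def)
qed

section \<open>Dependence cells of iterates of a cellular automaton\<close>

text \<open>
  This is the Minkowski sum of \<open>A\<close> with \<open>k\<close> copies of \<open>N\<close>.
\<close>

primrec dependence_cells :: "(int ^ 'd) set \<Rightarrow> nat \<Rightarrow> (int ^ 'd) set \<Rightarrow> (int ^ 'd) set" where
  "dependence_cells N 0 A = A"
| "dependence_cells N (Suc k) A = (\<Union>i\<in>dependence_cells N k A. (+) i ` N)"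

lemma finite_dependence_cells:
  "finite N \<Longrightarrow> finite A \<Longrightarrow> finite (dependence_cells N k A)"
  by (induction k) auto

lemma card_dependence_cells_le:
  assumes "finite N" "finite A"
  shows "card (dependence_cells N k A) \<le> card A * card N ^ k"
proof (induction k)
  case (Suc k)
  have "card (dependence_cells N (Suc k) A) \<le> (\<Sum>i\<in>dependence_cells N k A. card ((+) i ` N))"
    using card_UN_le [OF finite_dependence_cells [OF assms]] by simp
  also have "\<dots> \<le> of_nat (card (dependence_cells N k A)) * card N"
    by (intro sum_bounded_above card_image_le assms(1))
  also have "\<dots> \<le> card A * card N ^ k * card N"
    using Suc by simp
  finally show ?case
    by (simp add: mult_ac)
qed simp

lemma CA_iterate_cong:
  assumes "CA_with_rule N f F"
    and "\<And>i. i \<in> dependence_cells N k A \<Longrightarrow> x i = y i" and "j \<in> A"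
  shows "(F ^^ k) x j = (F ^^ k) y j"
  using assms(2)
proof (induction k arbitrary: x y)
  case 0
  then show ?case
    using assms(3) by simp
next
  case (Suc k)
  have "F x i = F y i" if "i \<in> dependence_cells N k A" for i
  proof -
    have "local_pattern N x i = local_pattern N y i"
      using that Suc.prems by (auto simp: local_pattern_def restrict_def fun_eq_iff)
    then show ?thesis
      using assms(1) by (simp add: CA_with_rule_def)
  qed
  then show ?case
    using Suc.IH [of "F x" "F y"] by (simp add: funpow_swap1)
qed

section \<open>One step of a perturbation under an invariant measure\<close>

text \<open>
  Integrating \<open>\<Phi> x S\<close> over \<open>T\<close> alone already bounds the mass of \<open>S\<close> after one step, and by
  invariance this is the mass of \<open>S\<close> itself.
\<close>

lemma invariant_measure_ge:
  assumes kernel: "\<Phi> \<in> borel \<rightarrow>\<^sub>M prob_algebra borel" and inv: "invariant_measure \<Phi> \<pi>"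
    and S: "S \<in> sets borel" and T: "T \<in> sets borel" and c: "0 \<le> c"
    and ge: "\<And>x. x \<in> T \<Longrightarrow> c \<le> measure (\<Phi> x) S"
  shows "c * measure \<pi> T \<le> measure \<pi> S"
proof -
  have sets: "sets \<pi> = sets borel" and "prob_space \<pi>" and bind: "\<pi> \<bind> \<Phi> = \<pi>"
    using inv by (auto simp: invariant_measure_def space_prob_algebra)
  interpret prob_space \<pi> by fact
  have \<Phi>: "\<Phi> \<in> \<pi> \<rightarrow>\<^sub>M subprob_algebra borel"
    using measurable_prob_algebraD [OF kernel] measurable_cong_sets [OF sets refl] by blast
  have prob_\<Phi>: "prob_space (\<Phi> x)" for x
    using measurable_space [OF kernel, of x] by (simp add: space_prob_algebra)
  have "ennreal (c * prob T) = (\<integral>\<^sup>+x. ennreal c * indicator T x \<partial>\<pi>)"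
    using T c by (simp add: nn_integral_cmult_indicator sets emeasure_eq_measure ennreal_mult)
  also have "\<dots> \<le> (\<integral>\<^sup>+x. emeasure (\<Phi> x) S \<partial>\<pi>)"
  proof (rule nn_integral_mono)
    fix x
    interpret P: prob_space "\<Phi> x" by (rule prob_\<Phi>)
    show "ennreal c * indicator T x \<le> emeasure (\<Phi> x) S"
      using ge [of x] by (auto simp: indicator_def P.emeasure_eq_measure intro: ennreal_leI)
  qed
  also have "\<dots> = emeasure (\<pi> \<bind> \<Phi>) S"
    using emeasure_bind [OF not_empty \<Phi> S] by simp
  also have "\<dots> = ennreal (prob S)"
    by (simp add: bind emeasure_eq_measure)
  finally show ?thesis
    by simp
qed

text \<open>
  The updates of distinct cells are independent given \<open>x\<close>, and each of them follows the rule of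
  \<open>F\<close> with probability at least \<open>1 - \<epsilon>\<close>.
\<close>

lemma perturbation_error_free:
  fixes F :: "('a::{finite, discrete_topology}, 'd::finite) config \<Rightarrow> ('a, 'd) config"
  assumes "CA_with_rule N f F" and "perturbation \<epsilon> N f \<Phi>" and "\<epsilon> \<le> 1" and "finite D"
  shows "(1 - \<epsilon>) ^ card D \<le> measure (\<Phi> x) (cylinder D (F x))"
proof -
  obtain \<phi> where pca: "PCA_with_rule N \<phi> \<Phi>"
    and \<phi>: "\<And>a. a \<in> N \<rightarrow>\<^sub>E UNIV \<Longrightarrow> 1 - \<epsilon> \<le> \<phi> a (f a)"
    using assms(2) by (auto simp: perturbation_def)
  have pattern: "local_pattern N x i \<in> N \<rightarrow>\<^sub>E UNIV" for i
    by (simp add: local_pattern_def)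
  have "(1 - \<epsilon>) ^ card D = (\<Prod>i\<in>D. 1 - \<epsilon>)"
    by simp
  also have "\<dots> \<le> (\<Prod>i\<in>D. \<phi> (local_pattern N x i) (restrict (F x) D i))"
    using assms(1,3) \<phi> [OF pattern] by (intro prod_mono) (auto simp: CA_with_rule_def)
  also have "\<dots> = measure (\<Phi> x) (cylinder D (restrict (F x) D))"
    using pca assms(4) restrict_PiE_iff [of "F x" D "\<lambda>_. UNIV"]
    unfolding PCA_with_rule_def by (metis UNIV_I)
  finally show ?thesis
    by simp
qed

section \<open>Mass of the constant pattern\<close>

text \<open>
  This is the chain of one-step bounds that leads from the cylinder of the all-\<open>z\<close> pattern to
  the event that \<open>F\<^sup>n x\<close> equals \<open>z\<close> on \<open>A\<close>.  The exponent adds up the bounds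
  \<open>card A * (card N)\<^sup>k\<close> on the number of cells on which a single step has to be error-free.
\<close>

lemma measure_iterate_constant_ge:
  fixes F :: "('a::{finite, discrete_topology}, 'd::finite) config \<Rightarrow> ('a, 'd) config"
  assumes CA: "CA_with_rule N f F" and pert: "perturbation \<epsilon> N f \<Phi>"
    and \<epsilon>: "0 \<le> \<epsilon>" "\<epsilon> \<le> 1" and inv: "invariant_measure \<Phi> \<pi>" and A: "finite A"
  shows "(1 - \<epsilon>) ^ (card A * (\<Sum>k<n. card N ^ k)) * measure \<pi> {x. \<forall>i\<in>A. (F ^^ n) x i = z}
           \<le> measure \<pi> (cylinder A (\<lambda>_. z))"
proof (induction n)
  case 0
  then show ?case
    by (simp add: cylinder_def)
next
  case (Suc n)
  let ?S = "\<lambda>k. {x. \<forall>i\<in>A. (F ^^ k) x i = z}"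
  define D where "D = dependence_cells N n A"
  have N: "finite N"
    using CA by (simp add: CA_with_rule_def)
  have kernel: "\<Phi> \<in> borel \<rightarrow>\<^sub>M prob_algebra borel"
    using pert by (auto simp: perturbation_def PCA_with_rule_def)
  have D: "finite D"
    using N A by (simp add: D_def finite_dependence_cells)
  have S_borel: "?S k \<in> sets borel" for k
    using CA_iterate_cong [OF CA, of k A]
    by (intro borel_local_event [OF finite_dependence_cells [OF N A, of k]]) fastforce
  have "(1 - \<epsilon>) ^ (card A * card N ^ n) * measure \<pi> (?S (Suc n)) \<le> measure \<pi> (?S n)"
  proof (rule invariant_measure_ge [OF kernel inv S_borel S_borel])
    fix x assume x: "x \<in> ?S (Suc n)"
    have prob_\<Phi>: "prob_space (\<Phi> x)" and sets: "sets (\<Phi> x) = sets borel"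
      using measurable_space [OF kernel, of x] by (simp_all add: space_prob_algebra)
    interpret prob_space "\<Phi> x" by fact
    have "(F ^^ n) y i = z" if "y \<in> cylinder D (F x)" "i \<in> A" for y i
    proof -
      have "(F ^^ n) y i = (F ^^ n) (F x) i"
        using that by (intro CA_iterate_cong [OF CA, of n A]) (auto simp: cylinder_def D_def)
      then show ?thesis
        using x that(2) by (simp add: funpow_swap1)
    qed
    then have sub: "cylinder D (F x) \<subseteq> ?S n"
      by blast
    have "(1 - \<epsilon>) ^ (card A * card N ^ n) \<le> (1 - \<epsilon>) ^ card D"
      using \<epsilon> card_dependence_cells_le [OF N A, of n] by (intro power_decreasing) (auto simp: D_def)
    also have "\<dots> \<le> prob (cylinder D (F x))"
      by (rule perturbation_error_free [OF CA pert \<epsilon>(2) D])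
    also have "\<dots> \<le> prob (?S n)"
      using sub S_borel by (intro finite_measure_mono) (auto simp: sets)
    finally show "(1 - \<epsilon>) ^ (card A * card N ^ n) \<le> prob (?S n)" .
  qed (use \<epsilon> in auto)
  then have "(1 - \<epsilon>) ^ (card A * (\<Sum>k<n. card N ^ k)) *
      ((1 - \<epsilon>) ^ (card A * card N ^ n) * measure \<pi> (?S (Suc n)))
      \<le> (1 - \<epsilon>) ^ (card A * (\<Sum>k<n. card N ^ k)) * measure \<pi> (?S n)"
    using \<epsilon> by (intro mult_left_mono) auto
  with Suc show ?case
    by (simp add: power_add distrib_left mult.assoc)
qed

theorem theorem3p1:
  fixes N :: "(int ^ 'd) set"
    and f :: "('a::{finite, discrete_topology}, 'd) config \<Rightarrow> 'a"
    and F :: "('a, 'd) config \<Rightarrow> ('a, 'd) config"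
    and z :: 'a
    and \<Phi> :: "real \<Rightarrow> ('a, 'd) config \<Rightarrow> ('a, 'd) config measure"
  assumes "CA_with_rule N f F"
    and "nilpotent F"
    and "\<exists>n\<ge>1. \<forall>x. (F ^^ n) x = (\<lambda>_. z)"
    and "\<And>\<epsilon>. \<epsilon> > 0 \<Longrightarrow> perturbation \<epsilon> N f (\<Phi> \<epsilon>)"
  shows "\<exists>C>0. \<forall>A \<epsilon> \<pi>. finite A \<longrightarrow> 0 < \<epsilon> \<longrightarrow> \<epsilon> < 1 \<longrightarrow> unique_invariant_measure (\<Phi> \<epsilon>) \<pi> \<longrightarrow>
           tv_dist A (dirac_const z) \<pi> \<le> 1 - (1 - \<epsilon>) powr (real (card A) * C) \<and>
           1 - (1 - \<epsilon>) powr (real (card A) * C) \<le> C * real (card A) * \<epsilon>"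
proof -
  obtain n where n: "n \<ge> 1" "\<And>x. (F ^^ n) x = (\<lambda>_. z)"
    using assms(3) by blast
  define c where "c = (\<Sum>k<n. card N ^ k)"
  \<comment> \<open>The term for \<open>k = 0\<close> is \<open>1\<close>, even when \<open>N\<close> is empty.\<close>
  have "card N ^ 0 \<le> c"
    unfolding c_def using n(1) by (intro member_le_sum) auto
  then have "real c > 0"
    by simp
  moreover have "tv_dist A (dirac_const z) \<pi> \<le> 1 - (1 - \<epsilon>) powr (real (card A) * real c) \<and>
      1 - (1 - \<epsilon>) powr (real (card A) * real c) \<le> real c * real (card A) * \<epsilon>"
    if A: "finite A" and \<epsilon>: "0 < \<epsilon>" "\<epsilon> < 1" and uniq: "unique_invariant_measure (\<Phi> \<epsilon>) \<pi>"
    for A \<epsilon> \<pi>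
  proof -
    have inv: "invariant_measure (\<Phi> \<epsilon>) \<pi>"
      using uniq by (simp add: unique_invariant_measure_def)
    then have \<pi>: "\<pi> \<in> space (prob_algebra borel)"
      by (simp add: invariant_measure_def)
    then have "prob_space \<pi>" and sets: "sets \<pi> = sets borel"
      by (simp_all add: space_prob_algebra)
    then have "measure \<pi> UNIV = 1"
      using prob_space.prob_space sets_eq_imp_space_eq [OF sets] by fastforce
    then have mass: "(1 - \<epsilon>) ^ (card A * c) \<le> measure \<pi> (cylinder A (\<lambda>_. z))"
      using measure_iterate_constant_ge [OF assms(1) assms(4) [OF \<epsilon>(1)] _ _ inv A, of n z] \<epsilon> n(2)
      by (simp add: c_def)
    have powr: "(1 - \<epsilon>) powr (real (card A) * real c) = (1 - \<epsilon>) ^ (card A * c)"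
      using \<epsilon> by (simp add: powr_realpow flip: of_nat_mult)
    have "1 + real (card A * c) * (- \<epsilon>) \<le> (1 + (- \<epsilon>)) ^ (card A * c)"
      using \<epsilon> by (intro Bernoulli_inequality) simp
    then show ?thesis
      using mass unfolding powr tv_dist_dirac_const [OF A \<pi>] by (simp add: mult_ac)
  qed
  ultimately show ?thesis
    by blast
qed

end
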